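(* Let $r\ge1$ be an integer, $k_1,\dots,k_r$ integers, and $a,b,c$ positive reals with $ab\ne1$. Then for every integer $n\ge0$, $$B^{(k_1,\dots,k_r)}_n(x;a,b,c)=\sum_{m_r>\dots>m_1>0}\frac{1}{m_1^{k_1}m_2^{k_2}\cdots m_r^{k_r}}\sum_{j=0}^{m_r-r}(-1)^j\binom{m_r-r}{j}\bigl(rx\ln c-j\ln a-(j+r)\ln b\bigr)^n.$$
   Context: The multiple polylogarithm is the formal power series $\mathrm{Li}_{(k_1,\dots,k_r)}(z)=\sum_{0<m_1<m_2<\dots<m_r}\frac{z^{m_r}}{m_1^{k_1}m_2^{k_2}\cdots m_r^{k_r}}$. For $u>0$ write $u^t=e^{t\ln u}$. The generalized multi poly-Bernoulli polynomials are defined by $$\frac{\mathrm{Li}_{(k_1,\dots,k_r)}(1-(ab)^{-t})}{(b^{t}-a^{-t})^r}\,c^{rxt}=\sum_{n=0}^{\infty}B^{(k_1,\dots,k_r)}_n(x;a,b,c)\frac{t^n}{n!}.$$ *)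

theory Defs
  imports "HOL-Analysis.Analysis" "HOL-Computational_Algebra.Formal_Power_Series"
begin

definition incr_tuples :: "nat \<Rightarrow> nat list set" where
  "incr_tuples r = {m. length m = r \<and> sorted_wrt (<) m \<and> (\<forall>i\<in>set m. 0 < i)}"

definition index_weight :: "int list \<Rightarrow> nat list \<Rightarrow> real" where
  "index_weight k m = (\<Prod>i<length k. real (m ! i) powi (k ! i))"

text \<open>The depth \<open>r\<close> is \<open>length k\<close> (meaningful for \<open>r \<ge> 1\<close>). The coefficient of \<open>z ^ N\<close> collects the
  finitely many tuples whose largest entry \<open>m\<^sub>r\<close> is \<open>N\<close>.\<close>

definition multi_polylog :: "int list \<Rightarrow> real fps" where
  "multi_polylog k =
     Abs_fps (\<lambda>N. \<Sum>m | m \<in> incr_tuples (length k) \<and> last m = N. 1 / index_weight k m)"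

text \<open>The formal power series \<open>u\<^bsup>s t\<^esup> = e\<^bsup>s t ln u\<^esup>\<close> in the variable \<open>t\<close>.\<close>

definition fps_powr :: "real \<Rightarrow> real \<Rightarrow> real fps" where
  "fps_powr u s = fps_exp (s * ln u)"

text \<open>The division below is exact, see \<open>multi_poly_bernoulli_egf_times\<close>.\<close>

definition multi_poly_bernoulli_egf ::
    "int list \<Rightarrow> real \<Rightarrow> real \<Rightarrow> real \<Rightarrow> real \<Rightarrow> real fps" where
  "multi_poly_bernoulli_egf k x a b c =
     fps_compose (multi_polylog k) (1 - fps_powr (a * b) (-1))
       / (fps_powr b 1 - fps_powr a (-1)) ^ length k
     * fps_powr c (real (length k) * x)"

definition multi_poly_bernoulli ::
    "int list \<Rightarrow> nat \<Rightarrow> real \<Rightarrow> real \<Rightarrow> real \<Rightarrow> real \<Rightarrow> real" where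
  "multi_poly_bernoulli k n x a b c =
     fact n * fps_nth (multi_poly_bernoulli_egf k x a b c) n"

lemma incr_tuples_last_ge:
  assumes "m \<in> incr_tuples r" "r \<ge> 1"
  shows "r \<le> last m"
proof -
  have m: "length m = r" "sorted_wrt (<) m" "\<forall>i\<in>set m. 0 < i"
    using assms by (auto simp: incr_tuples_def)
  have ne: "m \<noteq> []" using m(1) assms(2) by auto
  have "x \<le> last m" if x: "x \<in> set m" for x
  proof -
    from x obtain i where i: "i < length m" "x = m ! i" by (auto simp: in_set_conv_nth)
    show ?thesis
      using sorted_nth_mono[OF strict_sorted_imp_sorted[OF m(2)], of i "length m - 1"] i ne
      by (auto simp: last_conv_nth)
  qed
  hence "set m \<subseteq> {1..last m}" using m(3) by (auto simp: Suc_le_eq)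
  hence "card (set m) \<le> last m" using card_mono[of "{1..last m}" "set m"] by simp
  moreover have "distinct m" using m(2) by (simp add: strict_sorted_iff)
  ultimately show ?thesis using m(1) distinct_card by metis
qed

lemma multi_poly_bernoulli_egf_times:
  assumes "length k \<ge> 1" "a > 0" "b > 0" "a * b \<noteq> 1"
  shows "(fps_powr b 1 - fps_powr a (-1)) ^ length k \<noteq> 0"
    and "multi_poly_bernoulli_egf k x a b c * (fps_powr b 1 - fps_powr a (-1)) ^ length k =
         fps_compose (multi_polylog k) (1 - fps_powr (a * b) (-1)) * fps_powr c (real (length k) * x)"
proof -
  let ?r = "length k"
  define z where "z = 1 - fps_powr (a * b) (-1)"
  define D where "D = fps_powr b 1 - fps_powr a (-1)"
  have ln: "ln (a * b) = ln a + ln b" using assms by (simp add: ln_mult)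
  have z0: "fps_nth z 0 = 0" by (simp add: z_def fps_powr_def)
  have Dz: "D = fps_exp (ln b) * z"
    by (simp add: D_def z_def fps_powr_def ln algebra_simps flip: fps_exp_add_mult)
  have "fps_nth D 1 = ln (a * b)" by (simp add: D_def fps_powr_def ln)
  moreover have "ln (a * b) \<noteq> 0" using assms by simp
  ultimately have D0: "D \<noteq> 0" by auto
  thus "(fps_powr b 1 - fps_powr a (-1)) ^ length k \<noteq> 0" by (simp add: D_def)
  have c0: "fps_nth (multi_polylog k) N = 0" if "N < ?r" for N
  proof -
    have "{m. m \<in> incr_tuples ?r \<and> last m = N} = {}"
      using incr_tuples_last_ge[OF _ assms(1)] that by fastforce
    thus ?thesis by (simp only: multi_polylog_def fps_nth_Abs_fps sum.empty)
  qed
  have "multi_polylog k = fps_X ^ ?r * fps_shift ?r (multi_polylog k)"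
    using c0 by (intro fps_ext) (auto simp: fps_X_power_mult_nth)
  hence "fps_compose (multi_polylog k) z =
      fps_compose (fps_X ^ ?r) z * fps_compose (fps_shift ?r (multi_polylog k)) z"
    using fps_compose_mult_distrib[OF z0] by metis
  also have "fps_compose (fps_X ^ ?r) z = z ^ ?r"
    using z0 by (simp add: fps_compose_power[symmetric])
  finally have L: "z ^ ?r dvd fps_compose (multi_polylog k) z" by simp
  have "fps_exp (- ln b) * D = z"
    by (simp add: Dz mult.assoc[symmetric] flip: fps_exp_add_mult)
  hence "z ^ ?r = fps_exp (- ln b) ^ ?r * D ^ ?r" by (metis power_mult_distrib)
  with L have "D ^ ?r dvd fps_compose (multi_polylog k) z"
    by (metis dvd_mult_right)
  hence "fps_compose (multi_polylog k) z / D ^ ?r * D ^ ?r = fps_compose (multi_polylog k) z"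
    by simp
  thus "multi_poly_bernoulli_egf k x a b c * (fps_powr b 1 - fps_powr a (-1)) ^ length k =
         fps_compose (multi_polylog k) (1 - fps_powr (a * b) (-1)) * fps_powr c (real (length k) * x)"
    unfolding multi_poly_bernoulli_egf_def D_def[symmetric] z_def[symmetric]
    by (metis mult.assoc mult.commute)
qed

end

theory Submission
  imports Defs
begin

text \<open>Put \<open>z = 1 - (ab)\<^bsup>-t\<^esup>\<close>. Since \<open>b\<^bsup>t\<^esup> - a\<^bsup>-t\<^esup> = b\<^bsup>t\<^esup> z\<close>, dividing by the \<open>r\<close>-th power
  shifts the coefficients of the polylogarithm by \<open>r\<close>, so each tuple contributes its weight times
  \<open>z\<^bsup>m\<^sub>r - r\<^esup> b\<^bsup>-rt\<^esup> c\<^bsup>rxt\<^esup>\<close>. Expanding the power of \<open>z\<close> binomially gives the inner sum. As \<open>z\<close> has no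
  constant term, only tuples with \<open>m\<^sub>r \<le> n + r\<close> contribute to the coefficient of \<open>t\<^bsup>n\<^esup>\<close>: the
  sum over all tuples is in fact finite.\<close>

text \<open>The binomial theorem turns the product into a combination of exponentials with rates
  \<open>v + j * u\<close>, and \<open>fact n\<close> cancels the denominator in their
  coefficients.\<close>

lemma fps_nth_one_minus_exp_power_mult_exp:
  fixes u v :: "'a::field_char_0"
  shows "fact n * fps_nth ((1 - fps_exp u) ^ M * fps_exp v) n =
         (\<Sum>j\<le>M. (-1) ^ j * of_nat (M choose j) * (v + of_nat j * u) ^ n)"
proof -
  have summand: "of_nat (M choose j) * (- fps_exp u) ^ j * 1 ^ (M - j) * fps_exp v =
      fps_const ((-1) ^ j * of_nat (M choose j)) * fps_exp (v + of_nat j * u)" for j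
  proof -
    have "(- fps_exp u) ^ j = fps_const ((-1) ^ j) * fps_exp (of_nat j * u)"
      by (subst power_minus)
         (simp only: fps_exp_power_mult fps_const_power[symmetric] fps_const_neg[symmetric]
            fps_const_1_eq_1)
    thus ?thesis
      by (simp add: fps_exp_add_mult fps_of_nat[symmetric] flip: fps_const_mult)
  qed
  have "(1 - fps_exp u) ^ M * fps_exp v = (- fps_exp u + 1) ^ M * fps_exp v"
    by simp
  also have "\<dots> = (\<Sum>j\<le>M. fps_const ((-1) ^ j * of_nat (M choose j)) * fps_exp (v + of_nat j * u))"
    by (simp only: binomial_ring sum_distrib_right summand)
  finally show ?thesis
    by (simp add: fps_sum_nth sum_distrib_left)
qed

lemma fps_nth_power_mult_eq_0:
  fixes z g :: "'a::comm_ring_1 fps"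
  assumes "fps_nth z 0 = 0" "n < M"
  shows "fps_nth (z ^ M * g) n = 0"
  using assms by (simp add: fps_mult_nth startsby_zero_power_prefix)

lemma fps_nth_compose_mult:
  fixes f z g :: "'a::comm_ring_1 fps"
  assumes "fps_nth z 0 = 0"
  shows "fps_nth (fps_compose f z * g) n = (\<Sum>i\<le>n. fps_nth f i * fps_nth (z ^ i * g) n)"
proof -
  \<comment> \<open>Since \<open>z ^ i\<close> has order at least \<open>i\<close>, the range
    \<open>i \<le> l\<close> may be enlarged to the uniform range \<open>i \<le> n\<close>; this
    allows the swap of sums below.\<close>
  have "fps_nth (fps_compose f z) l = (\<Sum>i\<le>n. fps_nth f i * fps_nth (z ^ i) l)" if "l \<le> n" for l
    unfolding fps_compose_nth using that assms
    by (intro sum.mono_neutral_left) (auto simp: startsby_zero_power_prefix)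
  hence "fps_nth (fps_compose f z * g) n =
      (\<Sum>l=0..n. \<Sum>i\<le>n. fps_nth f i * fps_nth (z ^ i) l * fps_nth g (n - l))"
    by (simp add: fps_mult_nth sum_distrib_right)
  also have "\<dots> = (\<Sum>i\<le>n. fps_nth f i * fps_nth (z ^ i * g) n)"
    by (subst sum.swap) (simp add: fps_mult_nth sum_distrib_left mult.assoc)
  finally show ?thesis .
qed

lemma finite_incr_tuples_last: "finite {m \<in> incr_tuples r. last m = N}"
proof (rule finite_subset)
  show "{m \<in> incr_tuples r. last m = N} \<subseteq> {m. set m \<subseteq> {..N} \<and> length m = r}"
  proof safe
    fix m x assume m: "m \<in> incr_tuples r" and x: "x \<in> set m"
    have "sorted_wrt (<) m" using m by (simp add: incr_tuples_def)
    \<comment> \<open>The member \<open>x\<close> rules out the empty list, for which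
      \<open>last\<close> is unspecified.\<close>
    moreover have "m = butlast m @ [last m]" using x by (intro append_butlast_last_id[symmetric]) auto
    ultimately have "sorted_wrt (<) (butlast m @ [last m])" by simp
    moreover have "x \<in> set (butlast m @ [last m])" using x \<open>m = _\<close> by simp
    ultimately show "x \<le> last m" by (auto simp: sorted_wrt_append)
  qed (auto simp: incr_tuples_def)
  show "finite {m. set m \<subseteq> {..N} \<and> length m = r}"
    by (rule finite_lists_length_eq) simp
qed

lemma multi_polylog_nth_eq_0:
  assumes "length k \<ge> 1" "N < length k"
  shows "fps_nth (multi_polylog k) N = 0"
proof -
  have "{m. m \<in> incr_tuples (length k) \<and> last m = N} = {}"
    using incr_tuples_last_ge[OF _ assms(1)] assms(2) by fastforce
  thus ?thesis by (simp only: multi_polylog_def fps_nth_Abs_fps sum.empty)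
qed

text \<open>Removes the division: both sides agree after multiplication by \<open>D ^ r\<close>,
  which is nonzero because \<open>a * b \<noteq> 1\<close>, and power series over a field form an
  integral domain.\<close>

lemma multi_poly_bernoulli_egf_eq:
  assumes "length k \<ge> 1" "a > 0" "b > 0" "a * b \<noteq> 1"
  defines "r \<equiv> length k"
  shows "multi_poly_bernoulli_egf k x a b c =
    fps_compose (fps_shift r (multi_polylog k)) (1 - fps_exp (- ln (a * b))) *
      fps_exp (real r * x * ln c - real r * ln b)"
proof -
  define z where "z = 1 - fps_exp (- ln (a * b))"
  define D where "D = fps_powr b 1 - fps_powr a (-1)"
  define S where "S = fps_compose (fps_shift r (multi_polylog k)) z"
  have z0: "fps_nth z 0 = 0" by (simp add: z_def)
  have D: "D = fps_exp (ln b) * z"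
    using assms by (simp add: D_def z_def fps_powr_def ln_mult algebra_simps flip: fps_exp_add_mult)
  have Dr: "D ^ r = fps_exp (real r * ln b) * z ^ r"
    by (simp add: D power_mult_distrib fps_exp_power_mult)
  have "multi_polylog k = fps_X ^ r * fps_shift r (multi_polylog k)"
    using multi_polylog_nth_eq_0[OF assms(1)]
    by (intro fps_ext) (auto simp: fps_X_power_mult_nth r_def)
  hence Li: "fps_compose (multi_polylog k) z = z ^ r * S"
    using fps_compose_mult_distrib[OF z0] fps_compose_power[of z fps_X r] z0
    unfolding S_def by (metis fps_X_fps_compose_startby0)
  have "multi_poly_bernoulli_egf k x a b c * D ^ r =
      z ^ r * S * fps_exp (real r * x * ln c)"
    using multi_poly_bernoulli_egf_times(2)[OF assms(1-4), of x c] Li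
    by (simp add: D_def r_def z_def fps_powr_def)
  \<comment> \<open>The split-off factor \<open>fps_exp (real r * ln b)\<close> combines with
    \<open>z ^ r\<close> to \<open>D ^ r\<close>.\<close>
  also have "fps_exp (real r * x * ln c) =
      fps_exp (real r * x * ln c - real r * ln b) * fps_exp (real r * ln b)"
    by (simp flip: fps_exp_add_mult)
  also have "z ^ r * S * \<dots> = S * fps_exp (real r * x * ln c - real r * ln b) * D ^ r"
    by (simp only: Dr mult_ac)
  finally have "multi_poly_bernoulli_egf k x a b c * D ^ r =
      S * fps_exp (real r * x * ln c - real r * ln b) * D ^ r" .
  moreover have "D ^ r \<noteq> 0"
    using multi_poly_bernoulli_egf_times(1)[OF assms(1-4)] unfolding D_def r_def .
  ultimately show ?thesis
    by (auto simp: S_def z_def)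
qed

theorem theorem4p3:
  fixes r n :: nat and k :: "int list" and a b c x :: real
  assumes "r \<ge> 1" and "length k = r"
    and "a > 0" and "b > 0" and "c > 0" and "a * b \<noteq> 1"
  shows "((\<lambda>m. 1 / index_weight k m *
            (\<Sum>j\<le>last m - r. (-1) ^ j * real ((last m - r) choose j) *
               (real r * x * ln c - real j * ln a - real (j + r) * ln b) ^ n))
          has_sum multi_poly_bernoulli k n x a b c) (incr_tuples r)"
proof -
  define z where "z = 1 - fps_exp (- ln (a * b))"
  define g where "g = fps_exp (real r * x * ln c - real r * ln b)"
  define h where "h M = fact n * fps_nth (z ^ M * g) n" for M
  \<comment> \<open>Summing the weights \<open>1 / index_weight k m\<close> over \<open>T i\<close>
    gives coefficient \<open>i\<close> of the shifted polylogarithm.\<close>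
  define T where "T i = {m \<in> incr_tuples r. last m = i + r}" for i
  have z0: "fps_nth z 0 = 0" by (simp add: z_def)
  have inner: "(\<Sum>j\<le>M. (-1) ^ j * real (M choose j) *
      (real r * x * ln c - real j * ln a - real (j + r) * ln b) ^ n) = h M" for M
    unfolding h_def z_def g_def fps_nth_one_minus_exp_power_mult_exp
    using assms by (simp add: ln_mult algebra_simps)
  have h0: "h M = 0" if "n < M" for M
    using fps_nth_power_mult_eq_0[OF z0 that] by (simp add: h_def)
  have "multi_poly_bernoulli k n x a b c =
      fact n * (\<Sum>i\<le>n. fps_nth (multi_polylog k) (i + r) * fps_nth (z ^ i * g) n)"
    unfolding multi_poly_bernoulli_def using assms
    by (simp add: multi_poly_bernoulli_egf_eq fps_nth_compose_mult z0 flip: z_def g_def)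
  also have "\<dots> = (\<Sum>i\<le>n. \<Sum>m\<in>T i. 1 / index_weight k m * h (last m - r))"
    using assms(2)
    by (simp add: multi_polylog_def h_def T_def sum_distrib_left sum_distrib_right mult_ac)
  also have "\<dots> = (\<Sum>m\<in>(\<Union>i\<le>n. T i). 1 / index_weight k m * h (last m - r))"
    by (rule sum.UNION_disjoint[symmetric]) (auto simp: T_def finite_incr_tuples_last)
  finally have "((\<lambda>m. 1 / index_weight k m * h (last m - r)) has_sum
      multi_poly_bernoulli k n x a b c) (\<Union>i\<le>n. T i)"
    by (simp add: T_def finite_incr_tuples_last)
  moreover have "h (last m - r) = 0" if "m \<in> incr_tuples r - (\<Union>i\<le>n. T i)" for m
  proof (rule h0, rule ccontr)
    assume "\<not> n < last m - r"
    \<comment> \<open>This makes the truncated subtraction exact, so that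
      \<open>last m = (last m - r) + r\<close>.\<close>
    moreover have "r \<le> last m" using that assms(1) incr_tuples_last_ge by blast
    ultimately have "m \<in> T (last m - r)" "last m - r \<le> n" using that by (auto simp: T_def)
    thus False using that by blast
  qed
  ultimately have "((\<lambda>m. 1 / index_weight k m * h (last m - r)) has_sum
      multi_poly_bernoulli k n x a b c) (incr_tuples r)"
    by (subst has_sum_cong_neutral[where T = "\<Union>i\<le>n. T i"]) (auto simp: T_def)
  thus ?thesis by (simp only: inner)
qed

end
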